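(* Let $n\ge 3$ and consider the integer lattice graph $\mathbb{Z}^n$. Assume that $V:\mathbb{Z}^n\to\mathbb{R}$ satisfies $$0<V(x)\le c_0\,(1+|x|)^{-\alpha}\quad\text{for all }x\in\mathbb{Z}^n,$$ for some $\alpha>2$ and some constant $c_0>0$. Then there exist infinitely many bounded solutions of $\Delta u-Vu=0$ in $\mathbb{Z}^n$. More precisely, for any $\gamma\in\mathbb{R}$ there exists a bounded solution $u_\gamma:\mathbb{Z}^n\to\mathbb{R}$ of $\Delta u-Vu=0$ in $\mathbb{Z}^n$ such that $$\lim_{|x|\to+\infty}u_\gamma(x)=\gamma .$$
   Context: Integer lattice graph: the vertex set is $\mathbb{Z}^n$; $x\sim y$ if and only if there is $k\in\{1,\dots,n\}$ with $x_k=y_k\pm1$ and $x_i=y_i$ for $i\ne k$; the edge weight is $\omega(x,y)=1$ if $x\sim y$ and $0$ otherwise; the node measure is $\mu(x)=2n$. Here $|x|=\big(\sum_{k=1}^n|x_k|^2\big)^{1/2}$ is the Euclidean norm. The Laplace operator is $\Delta f(x)=\frac1{2n}\sum_{y\sim x}[f(y)-f(x)]$ for $f:\mathbb{Z}^n\to\mathbb{R}$. A function $u:\mathbb{Z}^n\to\mathbb{R}$ is a solution of $\Delta u-Vu=0$ in $\mathbb{Z}^n$ if $\Delta u(x)-V(x)u(x)=0$ for every $x\in\mathbb{Z}^n$. *)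

theory Defs
  imports "HOL-Analysis.Analysis"
begin

text \<open>
  The vertex set \<open>\<int>\<^sup>n\<close> is the type \<open>int ^ 'n\<close>, with \<open>n = CARD('n)\<close>.
\<close>

definition lattice_adj :: "int ^ 'n \<Rightarrow> int ^ 'n \<Rightarrow> bool" where
  "lattice_adj x y \<longleftrightarrow>
     (\<exists>k. (x $ k = y $ k + 1 \<or> x $ k = y $ k - 1) \<and> (\<forall>i. i \<noteq> k \<longrightarrow> x $ i = y $ i))"

definition lattice_norm :: "int ^ 'n \<Rightarrow> real" where
  "lattice_norm x = sqrt (\<Sum>k\<in>UNIV. \<bar>real_of_int (x $ k)\<bar>\<^sup>2)"

definition lattice_laplacian :: "(int ^ 'n \<Rightarrow> real) \<Rightarrow> int ^ 'n \<Rightarrow> real" where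
  "lattice_laplacian f x =
     1 / (2 * real CARD('n)) * (\<Sum>y\<in>{y. lattice_adj y x}. f y - f x)"

definition schroedinger_solution ::
    "(int ^ 'n \<Rightarrow> real) \<Rightarrow> (int ^ 'n \<Rightarrow> real) \<Rightarrow> bool" where
  "schroedinger_solution V u \<longleftrightarrow> (\<forall>x. lattice_laplacian u x - V x * u x = 0)"

text \<open>
  \<open>int ^ 'n\<close> is not a normed space, so \<open>at_infinity\<close> is not available; this is the filter
  of \<open>|x| \<rightarrow> +\<infinity>\<close>.
\<close>

definition lattice_at_infinity :: "(int ^ 'n) filter" where
  "lattice_at_infinity = filtercomap lattice_norm at_top"

text \<open>The sum in the Laplacian is a genuine finite sum.\<close>

lemma finite_lattice_neighbours: "finite {y. lattice_adj y (x :: int ^ 'n)}"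
proof -
  have "{y. lattice_adj y x} \<subseteq>
      (\<lambda>(k, d). \<chi> i. if i = k then x $ i + d else x $ i) ` (UNIV \<times> {1, -1})"
  proof
    fix y assume "y \<in> {y. lattice_adj y x}"
    then obtain k where k: "y $ k = x $ k + 1 \<or> y $ k = x $ k - 1"
        "\<forall>i. i \<noteq> k \<longrightarrow> y $ i = x $ i"
      by (auto simp: lattice_adj_def)
    have "y = (\<lambda>(k, d). \<chi> i. if i = k then x $ i + d else x $ i) (k, y $ k - x $ k)"
      using k(2) by (simp add: vec_eq_iff)
    moreover have "(k, y $ k - x $ k) \<in> UNIV \<times> {1, -1}"
      using k(1) by auto
    ultimately show "y \<in> (\<lambda>(k, d). \<chi> i. if i = k then x $ i + d else x $ i) ` (UNIV \<times> {1, -1})"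
      by (rule image_eqI)
  qed
  then show ?thesis by (rule finite_subset) simp
qed

end

theory Submission
  imports Defs
begin

text \<open>
  Writing \<open>A u\<close> for the average of \<open>u\<close> over the \<open>2n\<close> neighbours, the equation says
  \<open>u = A u / (1 + V)\<close>. The right-hand side is a monotone operator \<open>T\<close> in \<open>u\<close>, and \<open>T 1 \<le> 1\<close> because
  \<open>V \<ge> 0\<close>. Iterating \<open>T\<close> from the constant \<open>1\<close> therefore gives a decreasing sequence of
  nonnegative functions, whose pointwise limit \<open>w\<close> is a solution with \<open>0 \<le> w \<le> 1\<close>.

  What has to be excluded is that \<open>w\<close> degenerates: on a connected recurrent graph, such as
  \<open>\<int>\<^sup>2\<close>, it is identically zero as soon as \<open>V\<close> is positive somewhere. If \<open>h \<ge> 0\<close>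
  satisfies \<open>\<Delta> h \<le> - V\<close>, then \<open>1 - h\<close> is a subsolution, so it stays below all iterates and \<open>1 - h \<le> w \<le> 1\<close> (\<open>solution_above_barrier\<close>). If moreover \<open>h\<close> vanishes at
  infinity, then \<open>w\<close> tends to \<open>1\<close>, and \<open>\<gamma> w\<close> is the solution sought.

  A barrier is \<open>h = B (R + |x|\<^sup>2)\<^sup>-\<^sup>p\<close> with \<open>p\<close> small. Up to lower order, with \<open>t = R + |x|\<^sup>2\<close>,
  the neighbour sum \<open>\<Sum> (t\<^sub>y\<^sup>-\<^sup>p - t\<^sub>x\<^sup>-\<^sup>p)\<close> is at most
  \<open>(4 p (p + 1) - 2 n p) t\<^sup>-\<^sup>p\<^sup>-\<^sup>1\<close>, which is negative exactly for \<open>p < n / 2 - 1\<close>; here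
  \<open>n \<ge> 3\<close> leaves room for a positive \<open>p\<close>. The bound \<open>- c t\<^sup>-\<^sup>p\<^sup>-\<^sup>1\<close> has the size of
  \<open>(1 + |x|)\<^bsup>- 2 p - 2\<^esup>\<close>, and \<open>2 p + 2 \<le> \<alpha>\<close> can be arranged because \<open>\<alpha> > 2\<close>
  (\<open>barrier_exists\<close>). Choosing \<open>R\<close> large makes the Taylor expansion valid at every vertex,
  including those near the origin.
\<close>

section \<open>The Laplacian as a sum over coordinate directions\<close>

definition nbr_sum :: "(int ^ 'n \<Rightarrow> real) \<Rightarrow> int ^ 'n \<Rightarrow> real" where
  "nbr_sum f x = (\<Sum>k\<in>UNIV. f (x + axis k 1) + f (x - axis k 1))"

lemma sum_neighbours:
  fixes f :: "int ^ 'n \<Rightarrow> real"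
  shows "(\<Sum>y\<in>{y. lattice_adj y x}. f y) = nbr_sum f x"
proof -
  let ?g = "\<lambda>(k :: 'n, d :: int). x + axis k d"
  have "bij_betw ?g (UNIV \<times> {1, -1}) {y. lattice_adj y x}"
    unfolding bij_betw_def
  proof
    show "inj_on ?g (UNIV \<times> {1, -1})"
      by (auto simp: inj_on_def axis_eq_axis)
    show "?g ` (UNIV \<times> {1, -1}) = {y. lattice_adj y x}"
    proof (intro equalityI subsetI)
      fix y assume "y \<in> ?g ` (UNIV \<times> {1, -1})"
      then obtain k d where y: "y = x + axis k d" "d = 1 \<or> d = -1" by auto
      then show "y \<in> {y. lattice_adj y x}"
        by (auto simp: lattice_adj_def axis_def intro!: exI[of _ k])
    next
      fix y assume "y \<in> {y. lattice_adj y x}"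
      then obtain k where k: "y $ k = x $ k + 1 \<or> y $ k = x $ k - 1"
          "\<forall>i. i \<noteq> k \<longrightarrow> y $ i = x $ i"
        by (auto simp: lattice_adj_def)
      have "y = ?g (k, y $ k - x $ k)"
        using k(2) by (simp add: vec_eq_iff axis_def)
      moreover have "(k, y $ k - x $ k) \<in> UNIV \<times> {1, -1}"
        using k(1) by auto
      ultimately show "y \<in> ?g ` (UNIV \<times> {1, -1})" by (rule image_eqI)
    qed
  qed
  then have "(\<Sum>y\<in>{y. lattice_adj y x}. f y) = (\<Sum>p\<in>UNIV \<times> {1, -1}. f (?g p))"
    by (rule sum.reindex_bij_betw[symmetric])
  also have "\<dots> = (\<Sum>k\<in>UNIV. \<Sum>d\<in>{1, -1}. f (x + axis k d))"
    by (subst sum.cartesian_product) (rule sum.cong, auto)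
  also have "\<dots> = nbr_sum f x"
  proof -
    have "x + axis k (-1) = x - axis k 1" for k
      by (simp add: vec_eq_iff axis_def)
    then show ?thesis by (simp add: nbr_sum_def)
  qed
  finally show ?thesis .
qed

lemma lattice_laplacian_nbr_sum:
  fixes f :: "int ^ 'n \<Rightarrow> real"
  shows "lattice_laplacian f x = nbr_sum f x / (2 * real CARD('n)) - f x"
proof -
  have "(\<Sum>y\<in>{y. lattice_adj y x}. f y - f x) = nbr_sum (\<lambda>y. f y - f x) x"
    by (rule sum_neighbours)
  also have "\<dots> = nbr_sum f x - 2 * real CARD('n) * f x"
    by (simp add: nbr_sum_def sum.distrib sum_subtractf algebra_simps)
  finally show ?thesis
    by (simp add: lattice_laplacian_def field_simps)
qed

lemma nbr_sum_mono:
  assumes "\<And>y. f y \<le> g y"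
  shows "nbr_sum f x \<le> nbr_sum g x"
  unfolding nbr_sum_def by (intro sum_mono add_mono assms)

lemma schroedinger_solution_scale:
  assumes "schroedinger_solution V u"
  shows "schroedinger_solution V (\<lambda>x. c * u x)"
proof -
  have "lattice_laplacian (\<lambda>x. c * u x) x = c * lattice_laplacian u x" for x
    by (simp add: lattice_laplacian_def sum_distrib_left right_diff_distrib mult.left_commute)
  then have "lattice_laplacian (\<lambda>x. c * u x) x - V x * (c * u x)
      = c * (lattice_laplacian u x - V x * u x)" for x
    by (simp add: algebra_simps)
  with assms show ?thesis by (simp add: schroedinger_solution_def)
qed

section \<open>Monotone iteration between a barrier and a constant\<close>

text \<open>
  The iterates \<open>W k\<close> of the constant \<open>1\<close> under \<open>u \<mapsto> A u / (1 + V)\<close> decrease. The function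
  \<open>1 - h\<close> is a subsolution, since \<open>\<Delta> (1 - h) \<ge> V \<ge> V (1 - h)\<close>; the operator does not
  decrease it, and monotonicity keeps every iterate above it.
\<close>

lemma solution_above_barrier:
  fixes V h :: "int ^ 'n \<Rightarrow> real"
  assumes V: "\<And>x. 0 \<le> V x" and h: "\<And>x. 0 \<le> h x"
    and barrier: "\<And>x. lattice_laplacian h x \<le> - V x"
  obtains w where "schroedinger_solution V w" "\<And>x. 0 \<le> w x" "\<And>x. w x \<le> 1" "\<And>x. 1 - h x \<le> w x"
proof -
  define N where "N = 2 * real CARD('n)"
  have N: "N > 0" by (simp add: N_def)
  define T where "T u x = nbr_sum u x / N / (1 + V x)" for u x
  have V1: "1 + V x > 0" for x using V[of x] by simp
  have nbr_const: "nbr_sum (\<lambda>_. c) x = N * c" for c and x :: "int ^ 'n"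
    by (simp add: nbr_sum_def N_def)
  have T_mono: "T f x \<le> T g x" if "\<And>y. f y \<le> g y" for f g x
    unfolding T_def using nbr_sum_mono[of f g x, OF that] N V1[of x]
    by (intro divide_right_mono) auto
  define W where "W k = (T ^^ k) (\<lambda>_. 1)" for k
  have W_0: "W 0 = (\<lambda>_. 1)" and W_Suc: "W (Suc k) = T (W k)" for k
    by (simp_all add: W_def)
  have W_dec: "W (Suc k) x \<le> W k x" for k x
  proof (induction k arbitrary: x)
    case 0
    show ?case using N V1[of x] V[of x] by (simp add: W_Suc W_0 T_def nbr_const)
  next
    case (Suc k)
    show ?case unfolding W_Suc[of "Suc k"] unfolding W_Suc[of k]
      using Suc.IH by (intro T_mono) (simp add: W_Suc)
  qed
  have W_nonneg: "0 \<le> W k x" for k x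
  proof (induction k arbitrary: x)
    case (Suc k)
    have "T (\<lambda>_. 0) x \<le> T (W k) x" by (rule T_mono) (rule Suc.IH)
    then show ?case by (simp add: W_Suc T_def nbr_const)
  qed (simp add: W_0)
  have T_sub: "1 - h x \<le> T (\<lambda>y. 1 - h y) x" for x
  proof -
    have "nbr_sum (\<lambda>y. 1 - h y) x = N - nbr_sum h x"
      by (simp add: nbr_sum_def N_def sum.distrib sum_subtractf sum_negf)
    then have "nbr_sum (\<lambda>y. 1 - h y) x / N = 1 - nbr_sum h x / N"
      using N by (simp add: field_simps)
    also have "\<dots> \<ge> 1 + V x - h x"
      using barrier[of x] by (simp add: lattice_laplacian_nbr_sum N_def)
    finally have "nbr_sum (\<lambda>y. 1 - h y) x / N \<ge> 1 + V x - h x" .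
    moreover have "(1 - h x) * (1 + V x) \<le> 1 + V x - h x"
      using mult_nonneg_nonneg[OF h[of x] V[of x]] by (simp add: algebra_simps)
    ultimately show ?thesis using V1[of x] unfolding T_def pos_le_divide_eq[OF V1] by linarith
  qed
  have W_barrier: "1 - h x \<le> W k x" for k x
  proof (induction k arbitrary: x)
    case (Suc k)
    have "T (\<lambda>y. 1 - h y) x \<le> T (W k) x" by (rule T_mono) (rule Suc.IH)
    with T_sub[of x] show ?case by (simp add: W_Suc)
  qed (simp add: W_0 h)
  have W_le: "W k x \<le> 1" for k x
  proof (induction k)
    case (Suc k)
    show ?case by (rule order_trans[OF W_dec Suc.IH])
  qed (simp add: W_0)
  define w where "w x = lim (\<lambda>k. W k x)" for x
  have W_lim: "(\<lambda>k. W k x) \<longlonglongrightarrow> w x" for x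
  proof -
    have "decseq (\<lambda>k. W k x)" by (rule decseq_SucI) (rule W_dec)
    then obtain L where "(\<lambda>k. W k x) \<longlonglongrightarrow> L"
      by (rule decseq_convergent[where B = 0]) (auto intro: W_nonneg)
    then have "convergent (\<lambda>k. W k x)" by (rule convergentI)
    then show ?thesis by (simp add: w_def convergent_LIMSEQ_iff)
  qed
  have "T w x = w x" for x
  proof -
    have "(\<lambda>k. T (W k) x) \<longlonglongrightarrow> T w x"
      unfolding T_def nbr_sum_def using N V1[of x]
      by (intro tendsto_divide tendsto_sum tendsto_add W_lim tendsto_const) auto
    moreover have "(\<lambda>k. T (W k) x) \<longlonglongrightarrow> w x"
      using LIMSEQ_Suc[OF W_lim[of x]] by (simp add: W_Suc)
    ultimately show ?thesis by (rule LIMSEQ_unique)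
  qed
  then have "nbr_sum w x / N = w x * (1 + V x)" for x
    using V1[of x] unfolding T_def by (metis less_numeral_extra(3) nonzero_divide_eq_eq)
  then have "schroedinger_solution V w"
    by (simp add: schroedinger_solution_def lattice_laplacian_nbr_sum N_def algebra_simps)
  moreover have "0 \<le> w x" "1 - h x \<le> w x" for x
    using LIMSEQ_le_const[OF W_lim[of x]] W_nonneg W_barrier by blast+
  moreover have "w x \<le> 1" for x
    using LIMSEQ_le_const2[OF W_lim[of x]] W_le by blast
  ultimately show ?thesis using that by blast
qed

section \<open>A power barrier\<close>

text \<open>
  Second-order Taylor expansion: the odd terms cancel and the leading coefficient is
  \<open>p (p + 1)\<close>. In dimension three, the barrier needs a coefficient below \<open>3 p / 2\<close>; for
  \<open>p \<le> 1 / 8\<close> it is at most \<open>9 p / 8\<close>, and the slack up to \<open>5 p / 4\<close> absorbs the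
  remainder.
\<close>

lemma powr_symmetric_second_difference:
  fixes p z :: real
  assumes p: "0 < p" "p \<le> 1 / 8" and z: "\<bar>z\<bar> \<le> 1 / 30"
  shows "(1 + z) powr (- p) + (1 - z) powr (- p) \<le> 2 + 5 / 4 * p * z\<^sup>2"
proof -
  have one: "(1 + y) powr (- p) \<le> 1 - p * y + 5 / 8 * p * y\<^sup>2" if y: "\<bar>y\<bar> \<le> 1 / 30" for y
  proof (cases "y = 0")
    case False
    define D where "D m s = (if m = 0 then (1 + s) powr (- p)
        else if m = 1 then - p * (1 + s) powr (- p - 1)
        else p * (p + 1) * (1 + s) powr (- p - 2))" for m :: nat and s :: real
    have deriv: "DERIV (D m) s :> D (Suc m) s" if "m < 2" "-1/30 \<le> s" "s \<le> 1/30" for m s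
    proof -
      have "m = 0 \<or> m = 1" using \<open>m < 2\<close> by auto
      then show ?thesis
      proof
        assume "m = 0"
        then show ?thesis unfolding D_def using that
          by (auto intro!: derivative_eq_intros)
      next
        assume "m = 1"
        then show ?thesis unfolding D_def using that
          by (auto intro!: derivative_eq_intros simp: algebra_simps)
      qed
    qed
    have *: "\<exists>s. (if y < 0 then y < s \<and> s < 0 else 0 < s \<and> s < y) \<and>
        D 0 y = (\<Sum>m<2. D m 0 / fact m * (y - 0) ^ m) + D 2 s / fact 2 * (y - 0) ^ 2"
      by (rule Taylor[where f = "D 0" and a = "-1/30" and b = "1/30"])
        (use deriv y False in auto)
    then obtain s where s: "\<bar>s\<bar> \<le> 1 / 30"
        and eq: "D 0 y = (\<Sum>m<2. D m 0 / fact m * (y - 0) ^ m) + D 2 s / fact 2 * (y - 0) ^ 2"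
    proof -
      have "\<bar>s\<bar> \<le> 1 / 30" if "if y < 0 then y < s \<and> s < 0 else 0 < s \<and> s < y" for s
        using that y by (auto split: if_splits)
      then show ?thesis using * that by blast
    qed
    have "(1 + s) powr (- p - 2) \<le> (29 / 30) powr (- p - 2)"
      using s p by (intro powr_mono2') auto
    also have "\<dots> \<le> (29 / 30) powr (- 3)"
      using p by (intro powr_mono') auto
    also have "\<dots> \<le> (10 / 9 :: real)"
      by (simp add: powr_minus powr_numeral power3_eq_cube field_simps)
    finally have "(p + 1) * (1 + s) powr (- p - 2) \<le> 9 / 8 * (10 / 9)"
      using p by (intro mult_mono) auto
    then have "p * ((p + 1) * (1 + s) powr (- p - 2)) \<le> p * (5 / 4)"
      using p by (intro mult_left_mono) auto
    then have "D 2 s / 2 * y\<^sup>2 \<le> 5 / 8 * p * y\<^sup>2"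
      by (intro mult_right_mono) (auto simp: D_def mult.assoc)
    moreover have "D 0 y = 1 - p * y + D 2 s / 2 * y\<^sup>2"
      using eq by (simp add: numeral_2_eq_2 D_def)
    ultimately show ?thesis by (simp add: D_def)
  qed simp
  show ?thesis using one[of z] one[of "- z"] z by simp
qed

lemma powr_shift_lower_bound:
  fixes p t :: real
  assumes "0 < p" "1 < t"
  shows "t powr (- p) + p * t powr (- p - 1) \<le> (t - 1) powr (- p)"
proof -
  have "\<exists>s. t - 1 < s \<and> s < t \<and>
      t powr (- p) - (t - 1) powr (- p) = (t - (t - 1)) * (- p * s powr (- p - 1))"
    by (rule MVT2) (use assms in \<open>auto intro!: derivative_eq_intros\<close>)
  then obtain s where s: "t - 1 < s" "s < t"
      "t powr (- p) - (t - 1) powr (- p) = - p * s powr (- p - 1)"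
    by auto
  have "t powr (- p - 1) \<le> s powr (- p - 1)"
    using s assms by (intro powr_mono2') auto
  then have "p * t powr (- p - 1) \<le> p * s powr (- p - 1)"
    using assms by (intro mult_left_mono) auto
  with s(3) show ?thesis by simp
qed

lemma lattice_norm_power2: "(lattice_norm x)\<^sup>2 = (\<Sum>k\<in>UNIV. (real_of_int (x $ k))\<^sup>2)"
  unfolding lattice_norm_def by (subst real_sqrt_pow2) (auto intro: sum_nonneg)

lemma lattice_norm_nonneg: "0 \<le> lattice_norm x"
  unfolding lattice_norm_def by (intro real_sqrt_ge_zero sum_nonneg) auto

lemma lattice_norm_power2_add_axis:
  fixes x :: "int ^ 'n"
  assumes "d = 1 \<or> d = -1"
  shows "(lattice_norm (x + axis k d))\<^sup>2
    = (lattice_norm x)\<^sup>2 + 2 * real_of_int d * real_of_int (x $ k) + 1"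
proof -
  have "(lattice_norm (x + axis k d))\<^sup>2 = (\<Sum>i\<in>UNIV. (real_of_int (x $ i))\<^sup>2
      + (if i = k then 2 * real_of_int d * real_of_int (x $ k) + 1 else 0))"
    unfolding lattice_norm_power2
    by (rule sum.cong) (use assms in \<open>auto simp: axis_def power2_eq_square algebra_simps\<close>)
  then show ?thesis by (simp add: sum.distrib lattice_norm_power2)
qed

text \<open>
  The neighbours of \<open>x\<close> come in pairs with \<open>|y|\<^sup>2 = |x|\<^sup>2 + 1 \<plusminus> 2 x\<^sub>k\<close>, so the expansion is
  centred at \<open>t = 901 + |x|\<^sup>2\<close>. The constant \<open>900\<close> makes \<open>2 |x\<^sub>k| / t \<le> 1 / 30\<close> at every
  vertex, by \<open>(|x\<^sub>k| - 30)\<^sup>2 \<ge> 0\<close>. Moving the centre by \<open>1\<close> relative to the value at \<open>x\<close> gains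
  \<open>2 n p t\<^sup>-\<^sup>p\<^sup>-\<^sup>1\<close>, whereas the second differences cost at most \<open>5 p t\<^sup>-\<^sup>p\<^sup>-\<^sup>1\<close>; the gain
  wins by at least \<open>p t\<^sup>-\<^sup>p\<^sup>-\<^sup>1\<close> once \<open>n \<ge> 3\<close>.
\<close>

lemma laplacian_power_le:
  fixes x :: "int ^ 'n" and p :: real
  assumes n: "CARD('n) \<ge> 3" and p: "0 < p" "p \<le> 1 / 8"
  shows "lattice_laplacian (\<lambda>y. (900 + (lattice_norm y)\<^sup>2) powr (- p)) x
    \<le> - (p / (2 * real CARD('n))) * (901 + (lattice_norm x)\<^sup>2) powr (- p - 1)"
proof -
  let ?f = "\<lambda>y :: int ^ 'n. (900 + (lattice_norm y)\<^sup>2) powr (- p)"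
  define n where "n = real CARD('n)"
  define t where "t = 901 + (lattice_norm x)\<^sup>2"
  have t: "t \<ge> 901" by (simp add: t_def)
  define a where "a k = real_of_int (x $ k)" for k
  have pair: "?f (x + axis k 1) + ?f (x - axis k 1)
      \<le> t powr (- p) * (2 + 5 * p * (a k)\<^sup>2 / t\<^sup>2)" for k
  proof -
    define z where "z = 2 * a k / t"
    have "(a k)\<^sup>2 \<le> (lattice_norm x)\<^sup>2"
      unfolding a_def lattice_norm_power2
      by (rule member_le_sum[where f = "\<lambda>k. (real_of_int (x $ k))\<^sup>2"]) auto
    moreover have "60 * \<bar>a k\<bar> \<le> 900 + (a k)\<^sup>2"
      using zero_le_power2[of "\<bar>a k\<bar> - 30"] by (simp add: power2_diff)
    ultimately have z: "\<bar>z\<bar> \<le> 1 / 30"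
      using t unfolding z_def by (simp add: abs_mult t_def field_simps)
    have tz: "t * z = 2 * a k" using t by (simp add: z_def)
    have up: "900 + (lattice_norm (x + axis k 1))\<^sup>2 = t * (1 + z)"
      using tz by (simp add: lattice_norm_power2_add_axis a_def right_diff_distrib distrib_left)
        (simp add: t_def)
    have minus: "x - axis k 1 = x + axis k (-1)"
      by (simp add: vec_eq_iff axis_def)
    have down: "900 + (lattice_norm (x - axis k 1))\<^sup>2 = t * (1 - z)"
      unfolding minus
      using tz by (simp add: lattice_norm_power2_add_axis a_def right_diff_distrib distrib_left)
        (simp add: t_def)
    have "?f (x + axis k 1) + ?f (x - axis k 1)
        = t powr (- p) * ((1 + z) powr (- p) + (1 - z) powr (- p))"
    proof -
      have "(t * (1 + z)) powr (- p) = t powr (- p) * (1 + z) powr (- p)"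
        "(t * (1 - z)) powr (- p) = t powr (- p) * (1 - z) powr (- p)"
        using t z by (auto intro!: powr_mult)
      then show ?thesis unfolding up down by (simp only: distrib_left)
    qed
    also have "\<dots> \<le> t powr (- p) * (2 + 5 / 4 * p * z\<^sup>2)"
      by (intro mult_left_mono powr_symmetric_second_difference p z) auto
    also have "\<dots> = t powr (- p) * (2 + 5 * p * (a k)\<^sup>2 / t\<^sup>2)"
      by (simp add: z_def power_divide power_mult_distrib)
    finally show ?thesis .
  qed
  have "nbr_sum ?f x \<le> (\<Sum>k\<in>UNIV. t powr (- p) * (2 + 5 * p * (a k)\<^sup>2 / t\<^sup>2))"
    unfolding nbr_sum_def by (intro sum_mono pair)
  also have "\<dots> = t powr (- p) * (2 * n + 5 * p * (\<Sum>k\<in>UNIV. (a k)\<^sup>2) / t\<^sup>2)"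
    by (simp add: sum_distrib_left[symmetric] sum.distrib sum_divide_distrib[symmetric] n_def)
  also have "\<dots> \<le> t powr (- p) * (2 * n + 5 * p / t)"
  proof (intro mult_left_mono add_left_mono)
    have "(\<Sum>k\<in>UNIV. (a k)\<^sup>2) \<le> t" by (simp add: a_def t_def lattice_norm_power2)
    then have "5 * p * (\<Sum>k\<in>UNIV. (a k)\<^sup>2) / t\<^sup>2 \<le> 5 * p * t / t\<^sup>2"
      using p by (intro divide_right_mono mult_left_mono) auto
    then show "5 * p * (\<Sum>k\<in>UNIV. (a k)\<^sup>2) / t\<^sup>2 \<le> 5 * p / t"
      using t by (simp add: power2_eq_square)
  qed auto
  also have "\<dots> = 2 * n * t powr (- p) + 5 * p * t powr (- p - 1)"
    using t by (simp add: powr_diff algebra_simps)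
  finally have up: "nbr_sum ?f x \<le> 2 * n * t powr (- p) + 5 * p * t powr (- p - 1)" .
  have n3: "n \<ge> 3" using n by (simp add: n_def)
  have fx: "?f x = (t - 1) powr (- p)" by (simp add: t_def)
  have "2 * n * (t powr (- p) + p * t powr (- p - 1)) \<le> 2 * n * ?f x"
    unfolding fx using powr_shift_lower_bound[of p t] p t n3 by (intro mult_left_mono) auto
  moreover have "6 * (p * t powr (- p - 1)) \<le> 2 * n * (p * t powr (- p - 1))"
    using n3 p by (intro mult_right_mono) auto
  ultimately have "nbr_sum ?f x - 2 * n * ?f x \<le> - p * t powr (- p - 1)"
    using up by (simp add: algebra_simps)
  then have "(nbr_sum ?f x - 2 * n * ?f x) / (2 * n) \<le> - p * t powr (- p - 1) / (2 * n)"
    using n3 by (intro divide_right_mono) auto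
  then show ?thesis
    using n3 by (simp add: lattice_laplacian_nbr_sum n_def[symmetric] t_def[symmetric] diff_divide_distrib)
qed

lemma lattice_norm_at_top: "filterlim lattice_norm at_top lattice_at_infinity"
  unfolding lattice_at_infinity_def by (rule filterlim_filtercomap)

text \<open>
  The exponent \<open>p = min (1/8) ((\<alpha> - 2) / 2)\<close> satisfies \<open>2 (p + 1) \<le> \<alpha>\<close>. Since
  \<open>901 + |x|\<^sup>2 \<le> 901 (1 + |x|)\<^sup>2\<close>, minus the Laplacian of the power function then dominates
  \<open>(1 + |x|)\<^bsup>- \<alpha>\<^esup>\<close> up to a constant, which is absorbed by scaling.
\<close>

lemma barrier_exists:
  fixes \<alpha> c :: real
  assumes n: "CARD('n) \<ge> 3" and \<alpha>: "\<alpha> > 2" and c: "c > 0"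
  obtains h :: "int ^ 'n \<Rightarrow> real" where "\<And>x. 0 \<le> h x"
    "\<And>x. lattice_laplacian h x \<le> - (c * (1 + lattice_norm x) powr (- \<alpha>))"
    "(h \<longlongrightarrow> 0) lattice_at_infinity"
proof -
  define p where "p = min (1 / 8) ((\<alpha> - 2) / 2)"
  have p: "0 < p" "p \<le> 1 / 8" using \<alpha> by (auto simp: p_def)
  have "p \<le> (\<alpha> - 2) / 2" unfolding p_def by (rule min.cobounded2)
  then have p\<alpha>: "2 * (p + 1) \<le> \<alpha>" by simp
  define f where "f y = (900 + (lattice_norm y)\<^sup>2) powr (- p)" for y :: "int ^ 'n"
  define q where "q = p / (2 * real CARD('n))"
  define K where "K = (901 :: real) powr (- p - 1)"
  have pos: "q > 0" "K > 0" using p by (auto simp: q_def K_def)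
  define B where "B = c / (q * K)"
  have B: "B > 0" "B * (q * K) = c" using c pos by (auto simp: B_def)
  show thesis
  proof (rule that)
    show "0 \<le> B * f x" for x using B by (simp add: f_def)
  next
    fix x :: "int ^ 'n"
    define r where "r = lattice_norm x"
    have r: "r \<ge> 0" by (simp add: r_def lattice_norm_nonneg)
    have "K * (1 + r) powr (- \<alpha>) \<le> K * (1 + r) powr (- 2 * (p + 1))"
      using pos p\<alpha> r by (intro mult_left_mono powr_mono) auto
    also have "\<dots> = (901 * (1 + r)\<^sup>2) powr (- p - 1)"
    proof -
      have "(1 + r) powr (- 2 * (p + 1)) = ((1 + r) powr 2) powr (- p - 1)"
        unfolding powr_powr by (rule arg_cong) simp
      also have "(1 + r) powr 2 = (1 + r)\<^sup>2" using r by (simp add: powr_numeral)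
      finally show ?thesis using r by (simp add: K_def powr_mult)
    qed
    also have "\<dots> \<le> (901 + r\<^sup>2) powr (- p - 1)"
    proof (rule powr_mono2')
      show "901 + r\<^sup>2 \<le> 901 * (1 + r)\<^sup>2"
        using r by (simp add: power2_sum)
      show "0 < 901 + r\<^sup>2" using zero_le_power2[of r] by linarith
    qed (use p in auto)
    finally have "q * (K * (1 + r) powr (- \<alpha>)) \<le> q * (901 + r\<^sup>2) powr (- p - 1)"
      using pos by (intro mult_left_mono) auto
    also have "\<dots> \<le> - lattice_laplacian f x"
      using laplacian_power_le[OF n p, of x] by (simp add: f_def[abs_def] r_def q_def)
    finally have "B * (q * (K * (1 + r) powr (- \<alpha>))) \<le> B * - lattice_laplacian f x"
      using B by (intro mult_left_mono) auto
    moreover have "B * (q * (K * (1 + r) powr (- \<alpha>))) = c * (1 + r) powr (- \<alpha>)"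
      using B(2) by (simp add: mult.assoc[symmetric])
    moreover have "lattice_laplacian (\<lambda>x. B * f x) x = B * lattice_laplacian f x"
      by (simp add: lattice_laplacian_def sum_distrib_left right_diff_distrib mult.left_commute)
    ultimately show "lattice_laplacian (\<lambda>x. B * f x) x
        \<le> - (c * (1 + lattice_norm x) powr (- \<alpha>))"
      unfolding r_def by linarith
  next
    have "filterlim (\<lambda>x. 900 + (lattice_norm x)\<^sup>2) at_top (lattice_at_infinity :: (int ^ 'n) filter)"
      by (intro filterlim_tendsto_add_at_top[OF tendsto_const] filterlim_pow_at_top
          lattice_norm_at_top) simp
    then have "(f \<longlongrightarrow> 0) lattice_at_infinity"
      unfolding f_def using p by (intro tendsto_neg_powr) auto
    then show "((\<lambda>x. B * f x) \<longlongrightarrow> 0) lattice_at_infinity"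
      by (rule tendsto_mult_right_zero)
  qed
qed

section \<open>Bounded solutions with prescribed limit\<close>

lemma lattice_at_infinity_nontrivial: "(lattice_at_infinity :: (int ^ 'n) filter) \<noteq> bot"
proof -
  have unbounded: "\<exists>x :: int ^ 'n. lattice_norm x \<ge> r" for r
  proof
    let ?m = "\<lceil>\<bar>r\<bar>\<rceil>"
    let ?x = "axis undefined ?m :: int ^ 'n"
    have "(real_of_int (?x $ undefined))\<^sup>2 \<le> (lattice_norm ?x)\<^sup>2"
      unfolding lattice_norm_power2
      by (rule member_le_sum[where f = "\<lambda>k. (real_of_int (?x $ k))\<^sup>2"]) auto
    then have "(real_of_int ?m)\<^sup>2 \<le> (lattice_norm ?x)\<^sup>2" by simp
    then have "real_of_int ?m \<le> lattice_norm ?x"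
      by (rule power2_le_imp_le) (rule lattice_norm_nonneg)
    then show "lattice_norm ?x \<ge> r" by linarith
  qed
  show ?thesis
    unfolding lattice_at_infinity_def
  proof (rule filtercomap_neq_bot)
    fix P :: "real \<Rightarrow> bool" assume "eventually P at_top"
    then obtain r where "\<forall>s\<ge>r. P s" unfolding eventually_at_top_linorder by (rule exE)
    with unbounded[of r] show "\<exists>x :: int ^ 'n. P (lattice_norm x)" by blast
  qed
qed

theorem theorem3p12:
  fixes V :: "int ^ 'n \<Rightarrow> real" and c0 \<alpha> :: real
  assumes "CARD('n) \<ge> 3"
    and "\<alpha> > 2" and "c0 > 0"
    and "\<And>x. 0 < V x \<and> V x \<le> c0 * (1 + lattice_norm x) powr (- \<alpha>)"
  shows "infinite {u. bounded (range u) \<and> schroedinger_solution V u} \<and>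
    (\<forall>\<gamma>::real. \<exists>u. bounded (range u) \<and> schroedinger_solution V u \<and>
        (u \<longlongrightarrow> \<gamma>) lattice_at_infinity)"
proof -
  obtain h :: "int ^ 'n \<Rightarrow> real" where h: "\<And>x. 0 \<le> h x"
    "\<And>x. lattice_laplacian h x \<le> - (c0 * (1 + lattice_norm x) powr (- \<alpha>))"
    and h_lim: "(h \<longlongrightarrow> 0) lattice_at_infinity"
    using barrier_exists[OF assms(1-3)] by blast
  have "lattice_laplacian h x \<le> - V x" for x
    using h(2)[of x] assms(4)[of x] by linarith
  then obtain w where w: "schroedinger_solution V w" "\<And>x. 0 \<le> w x" "\<And>x. w x \<le> 1"
      "\<And>x. 1 - h x \<le> w x"
    using solution_above_barrier[of V h] h(1) assms(4) less_imp_le by metis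
  have "((\<lambda>x. 1 - h x) \<longlongrightarrow> 1) lattice_at_infinity"
    using tendsto_diff[OF tendsto_const[of 1] h_lim] by simp
  then have w_lim: "(w \<longlongrightarrow> 1) lattice_at_infinity"
    by (rule tendsto_sandwich[rotated 2, OF _ tendsto_const]) (use w in auto)
  define U where "U \<gamma> x = \<gamma> * w x" for \<gamma> x
  have U_bounded: "bounded (range (U \<gamma>))" for \<gamma>
  proof (rule boundedI)
    fix y assume "y \<in> range (U \<gamma>)"
    then obtain x where "y = \<gamma> * w x" by (auto simp: U_def)
    moreover have "\<bar>\<gamma>\<bar> * \<bar>w x\<bar> \<le> \<bar>\<gamma>\<bar> * 1"
      using w(2,3)[of x] by (intro mult_left_mono) auto
    ultimately show "norm y \<le> \<bar>\<gamma>\<bar>" by (simp add: abs_mult)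
  qed
  have U_sol: "schroedinger_solution V (U \<gamma>)" for \<gamma>
    unfolding U_def by (rule schroedinger_solution_scale) (rule w(1))
  have U_lim: "(U \<gamma> \<longlongrightarrow> \<gamma>) lattice_at_infinity" for \<gamma>
    unfolding U_def using tendsto_mult[OF tendsto_const[of \<gamma>] w_lim] by simp
  have "inj U"
    by (rule injI) (metis U_lim lattice_at_infinity_nontrivial tendsto_unique)
  then have "infinite (range U)"
    using finite_imageD infinite_UNIV_char_0 by blast
  moreover have "range U \<subseteq> {u. bounded (range u) \<and> schroedinger_solution V u}"
    using U_bounded U_sol by auto
  ultimately have "infinite {u. bounded (range u) \<and> schroedinger_solution V u}"
    using finite_subset by blast
  with U_bounded U_sol U_lim show ?thesis by blast
qed

end
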